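(* Let $P=P(A,a,b,b_a)$ be a lattice-free simplex with $|\det A|=\delta$, where $\delta=\delta\begin{pmatrix}A\\ a^T\end{pmatrix}$, and let $\Lambda=(A^T\mathbb{Z}^n)^*=A^{-1}\mathbb{Z}^n$. Then $$w^{\mathcal{F}}(P)<\operatorname{diam}(\Lambda/\mathbb{Z}^n)\le\delta-1.$$
   Context: Simplex: let $A\in\mathbb{Z}^{n\times n}$ be invertible, $b\in\mathbb{Z}^n$, $v$ the solution of $Av=b$, $C(A)=\{x\in\mathbb{R}^n: Ax\ge 0\}$ with dual cone $C(A)^*=\{x\in\mathbb{R}^n: y^Tx\ge 0\ \forall y\in C(A)\}$, let $a\in\mathbb{Z}^n$ with $-a\in\operatorname{int}(C(A)^* )$, and let $b_a$ be an integer with $b_a>a^Tv$. Then $P(A,a,b,b_a)=\{x\in\mathbb{R}^n: Ax\le b,\ a^Tx\le b_a\}$ is an $n$-dimensional simplex. It is lattice-free if it contains no point of $\mathbb{Z}^n$. For an integer matrix $M$ with $n$ columns and at least $n$ rows, $\delta(M)$ is the minimum of $|\det N|$ over all invertible $n\times n$ submatrices $N$ of $M$. For a lattice $\Gamma$ of full dimension, $\Gamma^*=\{x\in\mathbb{R}^n: y^Tx\in\mathbb{Z}\ \forall y\in\Gamma\}$. Facet width: $\mathcal{F}$ is the set of facet normals of $P$, i.e. the (transposed) rows of $A$ together with $a$, and $w^{\mathcal{F}}(P)=\min_{z\in\mathcal{F}}\big(\max_{x\in P}z^Tx-\min_{y\in P}z^Ty\big)$. Diameter: for a finite abelian group $G$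 and $H\subseteq G$ generating $G$, $\operatorname{diam}_H(G)$ is the least $k\in\mathbb{N}=\{0,1,2,\dots\}$ such that every element of $G$ is a sum $h^1+\dots+h^l$ with $h^i\in H$ (repetitions allowed) and $0\le l\le k$ (the empty sum being $0$); $\operatorname{diam}(G)=\max\{\operatorname{diam}_H(G): H\subseteq G\text{ generates }G\}$. *)

theory Defs
  imports "HOL-Analysis.Analysis" "HOL-Algebra.Generated_Groups"
begin

definition real_vec :: "int ^ 'n \<Rightarrow> real ^ 'n"
  where "real_vec x = (\<chi> i. of_int (x $ i))"

definition real_mat :: "int ^ 'n ^ 'm \<Rightarrow> real ^ 'n ^ 'm"
  where "real_mat A = (\<chi> i. real_vec (A $ i))"

definition int_lattice :: "(real ^ 'n) set"
  where "int_lattice = range real_vec"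

definition dual_lattice :: "(real ^ 'n) set \<Rightarrow> (real ^ 'n) set"
  where "dual_lattice \<Gamma> = {x. \<forall>y\<in>\<Gamma>. y \<bullet> x \<in> \<int>}"

text \<open>The order on vectors is componentwise.\<close>

definition cone_of :: "int ^ 'n ^ 'n \<Rightarrow> (real ^ 'n) set"
  where "cone_of A = {x. real_mat A *v x \<ge> 0}"

definition dual_cone_of :: "(real ^ 'n) set \<Rightarrow> (real ^ 'n) set"
  where "dual_cone_of K = {x. \<forall>y\<in>K. y \<bullet> x \<ge> 0}"

definition simplex_of :: "int ^ 'n ^ 'n \<Rightarrow> int ^ 'n \<Rightarrow> int ^ 'n \<Rightarrow> int \<Rightarrow> (real ^ 'n) set"
  where "simplex_of A a b b\<^sub>a =
    {x. real_mat A *v x \<le> real_vec b \<and> real_vec a \<bullet> x \<le> of_int b\<^sub>a}"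

definition lattice_free :: "(real ^ 'n) set \<Rightarrow> bool"
  where "lattice_free P \<longleftrightarrow> P \<inter> int_lattice = {}"

text \<open>The matrix \<open>A\<close> with the additional row \<open>a\<close>, indexed by \<open>None\<close>.\<close>

definition append_row :: "'a ^ 'n ^ 'm \<Rightarrow> 'a ^ 'n \<Rightarrow> 'a ^ 'n ^ ('m option)"
  where "append_row A a = (\<chi> i. case i of None \<Rightarrow> a | Some j \<Rightarrow> A $ j)"

text \<open>
  The square submatrices of maximal size are the selections of distinct rows. As index types
  carry no order, all orderings of the selected rows occur; they have the same determinant up to
  sign.
\<close>

definition full_submatrices :: "'a ^ 'n ^ 'm \<Rightarrow> ('a ^ 'n ^ 'n) set"
  where "full_submatrices M = {(\<chi> i. M $ f i) | f. inj f}"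

definition min_abs_det :: "int ^ 'n ^ 'm \<Rightarrow> int"
  where "min_abs_det M =
    Min {\<bar>det N\<bar> | N. N \<in> full_submatrices M \<and> invertible (real_mat N)}"

definition facet_normals :: "int ^ 'n ^ 'n \<Rightarrow> int ^ 'n \<Rightarrow> (real ^ 'n) set"
  where "facet_normals A a = insert (real_vec a) (rows (real_mat A))"

text \<open>On nonempty compact sets, such as the simplices above, supremum and infimum are attained.\<close>

definition width_along :: "real ^ 'n \<Rightarrow> (real ^ 'n) set \<Rightarrow> real"
  where "width_along z P = (SUP x\<in>P. z \<bullet> x) - (INF y\<in>P. z \<bullet> y)"

definition facet_width :: "(real ^ 'n) set \<Rightarrow> (real ^ 'n) set \<Rightarrow> real"
  where "facet_width F P = Min ((\<lambda>z. width_along z P) ` F)"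

definition additive_group :: "'a::ab_group_add set \<Rightarrow> 'a monoid"
  where "additive_group S = \<lparr>carrier = S, monoid.mult = (+), one = 0\<rparr>"

text \<open>
  Diameters are meant for finite abelian groups, which are written multiplicatively here: sums of
  generators become products.
\<close>

definition diam_wrt :: "('a, 'b) monoid_scheme \<Rightarrow> 'a set \<Rightarrow> nat"
  where "diam_wrt G H = (LEAST k. \<forall>g\<in>carrier G.
    \<exists>hs. set hs \<subseteq> H \<and> length hs \<le> k \<and> g = foldr (\<lambda>x y. x \<otimes>\<^bsub>G\<^esub> y) hs \<one>\<^bsub>G\<^esub>)"

definition group_diam :: "('a, 'b) monoid_scheme \<Rightarrow> nat"
  where "group_diam G = Max {diam_wrt G H | H. H \<subseteq> carrier G \<and> generate G H = carrier G}"

lemma dual_lattice_eq_inv_image: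
  fixes A :: "int ^ 'n ^ 'n"
  assumes "invertible (real_mat A)"
  shows "dual_lattice ((*v) (transpose (real_mat A)) ` int_lattice) =
    (*v) (matrix_inv (real_mat A)) ` int_lattice"
proof -
  let ?A = "real_mat A"
  have int_iff: "x \<in> int_lattice \<longleftrightarrow> (\<forall>i. x $ i \<in> \<int>)" for x :: "real ^ 'n"
  proof
    assume "\<forall>i. x $ i \<in> \<int>"
    then have "x = real_vec (\<chi> i. \<lfloor>x $ i\<rfloor>)"
      by (simp add: vec_eq_iff real_vec_def)
    then show "x \<in> int_lattice"
      by (auto simp: int_lattice_def)
  qed (auto simp: int_lattice_def real_vec_def)
  have dual: "x \<in> dual_lattice ((*v) (transpose ?A) ` int_lattice) \<longleftrightarrow> ?A *v x \<in> int_lattice" for x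
  proof
    assume x: "x \<in> dual_lattice ((*v) (transpose ?A) ` int_lattice)"
    have "axis i 1 \<bullet> (?A *v x) \<in> \<int>" for i
    proof -
      have "axis i 1 \<in> (int_lattice :: (real ^ 'n) set)"
        by (simp add: int_iff axis_def)
      with x show ?thesis
        by (auto simp: dual_lattice_def dot_lmul_matrix matrix_vector_mul_assoc
            transpose_matrix_vector)
    qed
    then show "?A *v x \<in> int_lattice"
      by (simp add: int_iff inner_axis')
  next
    assume x: "?A *v x \<in> int_lattice"
    have "(transpose ?A *v z) \<bullet> x \<in> \<int>" if "z \<in> int_lattice" for z
    proof -
      have "(transpose ?A *v z) \<bullet> x = z \<bullet> (?A *v x)"
        by (simp add: transpose_matrix_vector dot_lmul_matrix)
      then show ?thesis
        using that x by (auto simp: int_iff inner_vec_def)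
    qed
    then show "x \<in> dual_lattice ((*v) (transpose ?A) ` int_lattice)"
      by (auto simp: dual_lattice_def)
  qed
  have "?A ** matrix_inv ?A = mat 1 \<and> matrix_inv ?A ** ?A = mat 1"
    using assms unfolding invertible_def matrix_inv_def by (rule someI_ex)
  then have inv: "?A *v (matrix_inv ?A *v z) = z" "matrix_inv ?A *v (?A *v z) = z" for z
    by (simp_all add: matrix_vector_mul_assoc)
  show ?thesis
  proof (rule Set.set_eqI)
    fix x
    show "x \<in> dual_lattice ((*v) (transpose ?A) ` int_lattice) \<longleftrightarrow>
      x \<in> (*v) (matrix_inv ?A) ` int_lattice"
      unfolding dual using inv by (metis (no_types, opaque_lifting) imageE image_eqI)
  qed
qed

end

theory Submission
  imports Defs
begin

text \<open>
  Let \<open>G\<close> be the quotient of the lattice \<open>\<Lambda> = A\<inverse> \<int>\<^sup>n\<close> by \<open>\<int>\<^sup>n\<close>. Multiplication by \<open>A\<close> identifies it with the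
  quotient of \<open>\<int>\<^sup>n\<close> by \<open>A \<int>\<^sup>n\<close>.

  For the first inequality, write \<open>a = - (\<Sum>i. \<mu> i * A i)\<close> with the rows \<open>A i\<close> of \<open>A\<close>. As \<open>- a\<close> is interior
  to the dual cone, all \<open>\<mu> i\<close> are positive (\<open>interior_dual_cone_coefficients\<close>). In terms of the slacks
  \<open>y = b - A x\<close>, the simplex consists of all \<open>y \<ge> 0\<close> with \<open>\<mu> \<bullet> y \<le> \<beta>\<close>, where \<open>\<beta> = b\<^sub>a - a \<bullet> v\<close>. Hence its width
  along the row \<open>A i\<close> is at most \<open>\<beta> / \<mu> i\<close> (\<open>facet_width_simplex_le\<close>). The integer points have the slack
  vectors that are congruent to \<open>b\<close> modulo \<open>A \<int>\<^sup>n\<close>. The classes of the unit vectors generate \<open>G\<close>, so the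
  class of \<open>b\<close> is a sum of at most \<open>k = diam G\<close> of them; this is an integral slack vector \<open>y \<ge> 0\<close> with
  entries of sum at most \<open>k\<close> (\<open>nonneg_representative\<close>). For the largest coefficient \<open>\<mu> i\<close> it satisfies
  \<open>\<mu> \<bullet> y \<le> k * \<mu> i\<close>. As the simplex is lattice-free, \<open>\<mu> \<bullet> y > \<beta>\<close>. Together, \<open>\<beta> / \<mu> i < k\<close>.

  For the second inequality, the diameter of a finite group is less than its order
  (\<open>group_diam_le\<close>): the set of products of at most \<open>k\<close> generators grows with \<open>k\<close> until it is the
  whole group. The order of \<open>G\<close> is at most \<open>\<bar>det A\<bar>\<close> by comparison of volumes
  (\<open>card_incongruent_le_det\<close>).
\<close>

section \<open>Diameters of finite groups\<close>

definition word_products :: "('a, 'b) monoid_scheme \<Rightarrow> 'a set \<Rightarrow> nat \<Rightarrow> 'a set"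
  where "word_products G H k =
    {foldr (\<lambda>x y. x \<otimes>\<^bsub>G\<^esub> y) hs \<one>\<^bsub>G\<^esub> | hs. set hs \<subseteq> H \<and> length hs \<le> k}"

lemma diam_wrt_alt:
  "diam_wrt G H = (LEAST k. carrier G \<subseteq> word_products G H k)"
proof -
  have "(\<forall>g\<in>carrier G. \<exists>hs. set hs \<subseteq> H \<and> length hs \<le> k
      \<and> g = foldr (\<lambda>x y. x \<otimes>\<^bsub>G\<^esub> y) hs \<one>\<^bsub>G\<^esub>) \<longleftrightarrow> carrier G \<subseteq> word_products G H k" for k
    unfolding word_products_def by blast
  then show ?thesis
    unfolding diam_wrt_def by simp
qed

context group
begin

lemma word_products_subset:
  assumes "H \<subseteq> carrier G"
  shows "word_products G H k \<subseteq> carrier G"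
proof -
  have "set hs \<subseteq> H \<Longrightarrow> foldr (\<lambda>x y. x \<otimes> y) hs \<one> \<in> carrier G" for hs
    using assms by (induction hs) auto
  then show ?thesis
    by (auto simp: word_products_def)
qed

lemma word_products_mono: "k \<le> l \<Longrightarrow> word_products G H k \<subseteq> word_products G H l"
  unfolding word_products_def by (blast intro: le_trans)

lemma one_in_word_products: "\<one> \<in> word_products G H k"
  unfolding word_products_def by (auto intro!: exI[of _ "[]"])

lemma word_products_Suc:
  assumes "h \<in> H" "x \<in> word_products G H k"
  shows "h \<otimes> x \<in> word_products G H (Suc k)"
proof -
  from assms(2) obtain hs where "set hs \<subseteq> H" "length hs \<le> k" "x = foldr (\<lambda>x y. x \<otimes> y) hs \<one>"
    by (auto simp: word_products_def)
  then show ?thesis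
    using assms(1) unfolding word_products_def by (auto intro!: exI[of _ "h # hs"])
qed

text \<open>
  Left multiplication by a generator \<open>h\<close> maps the set \<open>W\<close> of short products injectively into itself,
  hence onto itself as \<open>W\<close> is finite. So \<open>W\<close> is also closed under left multiplication by \<open>inv h\<close>,
  and thus by every element of the group.
\<close>

lemma word_products_stable:
  assumes fin: "finite (carrier G)" and H: "H \<subseteq> carrier G" "generate G H = carrier G"
    and stable: "word_products G H (Suc k) = word_products G H k"
  shows "word_products G H k = carrier G"
proof -
  let ?W = "word_products G H k"
  have W: "?W \<subseteq> carrier G"
    using word_products_subset[OF H(1)] .
  have left: "h \<otimes> x \<in> ?W" if "h \<in> H" "x \<in> ?W" for h x
    using word_products_Suc[OF that] stable by simp
  have left_inv: "inv h \<otimes> x \<in> ?W" if h: "h \<in> H" and x: "x \<in> ?W" for h x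
  proof -
    have hc: "h \<in> carrier G"
      using h H by auto
    have "inj_on (\<lambda>x. h \<otimes> x) ?W"
      using hc W by (auto simp: inj_on_def subset_iff)
    moreover have "(\<lambda>x. h \<otimes> x) ` ?W \<subseteq> ?W"
      using left h by auto
    ultimately have "(\<lambda>x. h \<otimes> x) ` ?W = ?W"
      using finite_subset[OF W fin] by (simp add: endo_inj_surj)
    with x obtain w where w: "w \<in> ?W" "x = h \<otimes> w"
      by auto
    then have "inv h \<otimes> x = w"
      using hc W by (auto simp: m_assoc[symmetric] subset_iff)
    with w show ?thesis
      by simp
  qed
  have "\<forall>x\<in>?W. g \<otimes> x \<in> ?W" if "g \<in> generate G H" for g
    using that
  proof induction
    case one
    then show ?case using W by auto
  next
    case (incl h)
    then show ?case using left by auto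
  next
    case (inv h)
    then show ?case using left_inv by auto
  next
    case (eng h1 h2)
    then have "h1 \<in> carrier G" "h2 \<in> carrier G"
      using H by auto
    then show ?case
      using eng W by (auto simp: m_assoc subset_iff)
  qed
  then have "g \<in> ?W" if "g \<in> carrier G" for g
    using that one_in_word_products H(2) by (metis r_one)
  with W show ?thesis
    by auto
qed

text \<open>
  By the stability of the sets of products, each increment of the length adds a new element until
  the whole group is exhausted.
\<close>

lemma card_word_products:
  assumes fin: "finite (carrier G)" and H: "H \<subseteq> carrier G" "generate G H = carrier G"
    and "k < order G"
  shows "k < card (word_products G H k)"
  using \<open>k < order G\<close>
proof (induction k)
  case 0
  have "finite (word_products G H 0)"
    using finite_subset[OF word_products_subset[OF H(1)] fin] .
  then show ?case
    using one_in_word_products[of H 0] by (auto simp: card_gt_0_iff)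
next
  case (Suc k)
  then have IH: "k < card (word_products G H k)"
    by simp
  have fin': "finite (word_products G H (Suc k))"
    using finite_subset[OF word_products_subset[OF H(1)] fin] .
  show ?case
  proof (cases "word_products G H (Suc k) = word_products G H k")
    case True
    then have "word_products G H (Suc k) = carrier G"
      using word_products_stable[OF fin H] by simp
    then show ?thesis
      using Suc.prems by (simp add: order_def)
  next
    case False
    then have "word_products G H k \<subset> word_products G H (Suc k)"
      using word_products_mono[OF le_SucI[OF order_refl], of H k] by blast
    then have "card (word_products G H k) < card (word_products G H (Suc k))"
      by (rule psubset_card_mono[OF fin'])
    then show ?thesis
      using IH by linarith
  qed
qed

lemma word_products_eq_carrier:
  assumes fin: "finite (carrier G)" and H: "H \<subseteq> carrier G" "generate G H = carrier G"
  shows "word_products G H (order G - 1) = carrier G"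
proof (rule card_subset_eq[OF fin word_products_subset[OF H(1)]])
  have "0 < order G"
    using fin order_gt_0_iff_finite by blast
  then have "order G - 1 < card (word_products G H (order G - 1))"
    using card_word_products[OF fin H] by simp
  moreover have "card (word_products G H (order G - 1)) \<le> order G"
    unfolding order_def by (rule card_mono[OF fin word_products_subset[OF H(1)]])
  ultimately show "card (word_products G H (order G - 1)) = card (carrier G)"
    by (simp add: order_def)
qed

lemma diam_wrt_le:
  assumes "finite (carrier G)" "H \<subseteq> carrier G" "generate G H = carrier G"
  shows "diam_wrt G H \<le> order G - 1"
  unfolding diam_wrt_alt by (rule Least_le) (rule equalityD2[OF word_products_eq_carrier[OF assms]])

lemma carrier_subset_word_products_diam:
  assumes "finite (carrier G)" "H \<subseteq> carrier G" "generate G H = carrier G"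
  shows "carrier G \<subseteq> word_products G H (diam_wrt G H)"
  unfolding diam_wrt_alt by (rule LeastI) (rule equalityD2[OF word_products_eq_carrier[OF assms]])

lemma finite_diams:
  assumes "finite (carrier G)"
  shows "finite {diam_wrt G H | H. H \<subseteq> carrier G \<and> generate G H = carrier G}"
proof (rule finite_subset)
  show "{diam_wrt G H | H. H \<subseteq> carrier G \<and> generate G H = carrier G}
      \<subseteq> diam_wrt G ` Pow (carrier G)"
    by blast
qed (use assms in simp)

lemma diam_wrt_le_group_diam:
  assumes "finite (carrier G)" "H \<subseteq> carrier G" "generate G H = carrier G"
  shows "diam_wrt G H \<le> group_diam G"
  unfolding group_diam_def using assms by (intro Max_ge finite_diams) blast+

lemma group_diam_le:
  assumes fin: "finite (carrier G)"
  shows "group_diam G \<le> order G - 1"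
proof -
  let ?D = "{diam_wrt G H | H. H \<subseteq> carrier G \<and> generate G H = carrier G}"
  have "generate G (carrier G) = carrier G"
    using generate_incl[of "carrier G"] by (blast intro: generate.incl)
  then have "?D \<noteq> {}"
    by blast
  then have "group_diam G \<in> ?D"
    unfolding group_diam_def by (rule Max_in[OF finite_diams[OF fin]])
  then show ?thesis
    using diam_wrt_le[OF fin] by auto
qed

end

section \<open>Integer vectors and matrices\<close>

lemma real_vec_nth [simp]: "real_vec x $ i = of_int (x $ i)"
  by (simp add: real_vec_def)

lemma real_mat_nth [simp]: "real_mat A $ i $ j = of_int (A $ i $ j)"
  by (simp add: real_mat_def)

lemma real_vec_add: "real_vec (x + y) = real_vec x + real_vec y"
  by (simp add: vec_eq_iff)

lemma real_vec_diff: "real_vec (x - y) = real_vec x - real_vec y"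
  by (simp add: vec_eq_iff)

lemma real_vec_0: "real_vec 0 = 0"
  by (simp add: vec_eq_iff)

lemma real_vec_inject: "real_vec x = real_vec y \<longleftrightarrow> x = y"
  by (simp add: vec_eq_iff)

lemma real_mat_mult_real_vec: "real_mat A *v real_vec x = real_vec (A *v x)"
  by (simp add: vec_eq_iff matrix_vector_mult_def)

lemma det_real_mat: "det (real_mat A) = of_int (det A)"
  by (simp add: det_def)

lemma matrix_inv_mult_vector:
  fixes M :: "real ^ 'n ^ 'n"
  assumes "invertible M"
  shows "M *v (matrix_inv M *v x) = x" "matrix_inv M *v (M *v x) = x"
proof -
  have "M ** matrix_inv M = mat 1 \<and> matrix_inv M ** M = mat 1"
    using assms unfolding invertible_def matrix_inv_def by (rule someI_ex)
  then show "M *v (matrix_inv M *v x) = x" "matrix_inv M *v (M *v x) = x"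
    by (simp_all add: matrix_vector_mul_assoc)
qed

section \<open>The index of a lattice\<close>

text \<open>
  A copy of a finite index type on which a well-order is chosen. The formula for the volume of a
  linear image, which is used below, is about vectors whose indices are well-ordered.
\<close>

typedef 'a well_ordered = "UNIV :: 'a set" ..

lemma bij_Rep_well_ordered: "bij Rep_well_ordered"
  by (metis Abs_well_ordered_inverse Rep_well_ordered_inverse UNIV_I bij_betw_byWitness subset_UNIV)

instance well_ordered :: (finite) finite
proof
  have "(UNIV :: 'a well_ordered set) = range Abs_well_ordered"
    by (metis Rep_well_ordered_inverse surjI)
  then show "finite (UNIV :: 'a well_ordered set)"
    by (metis finite finite_imageI)
qed

instantiation well_ordered :: (finite) wellorder
begin

definition less_eq_well_ordered :: "'a well_ordered \<Rightarrow> 'a well_ordered \<Rightarrow> bool"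
  where "x \<le> y \<longleftrightarrow> to_nat (Rep_well_ordered x) \<le> to_nat (Rep_well_ordered y)"

definition less_well_ordered :: "'a well_ordered \<Rightarrow> 'a well_ordered \<Rightarrow> bool"
  where "x < y \<longleftrightarrow> to_nat (Rep_well_ordered x) < to_nat (Rep_well_ordered y)"

instance
proof
  fix P :: "'a well_ordered \<Rightarrow> bool" and a :: "'a well_ordered"
  assume "\<And>x. (\<And>y. y < x \<Longrightarrow> P y) \<Longrightarrow> P x"
  then show "P a"
    unfolding less_well_ordered_def
    by (rule measure_induct_rule[of "\<lambda>x. to_nat (Rep_well_ordered x)"]) blast
qed (auto simp: less_eq_well_ordered_def less_well_ordered_def Rep_well_ordered_inject)

end

lemma det_reindex:
  fixes A :: "'a::comm_ring_1 ^ 'n ^ 'n" and f :: "'m::finite \<Rightarrow> 'n"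
  assumes "bij f"
  shows "det (\<chi> i j. A $ f i $ f j) = det A"
proof -
  have inj: "inj f"
    using assms by (rule bij_is_inj)
  let ?h = "map_permutation UNIV f" and ?h' = "map_permutation UNIV (inv_into UNIV f)"
  have term_eq: "of_int (sign (?h p)) * (\<Prod>i\<in>UNIV. A $ i $ ?h p i)
      = of_int (sign p) * (\<Prod>i\<in>UNIV. A $ f i $ f (p i))" if "p permutes UNIV" for p
  proof -
    have "(\<Prod>i\<in>UNIV. A $ i $ ?h p i) = (\<Prod>i\<in>UNIV. A $ f i $ ?h p (f i))"
      by (rule prod.reindex_bij_betw[OF assms, symmetric])
    also have "\<dots> = (\<Prod>i\<in>UNIV. A $ f i $ f (p i))"
      using inj by (simp add: map_permutation_apply)
    finally show ?thesis
      using that inj by (simp add: sign_map_permutation)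
  qed
  have "(\<Sum>p | p permutes UNIV. of_int (sign p) * (\<Prod>i\<in>UNIV. A $ f i $ f (p i)))
      = (\<Sum>p | p permutes UNIV. of_int (sign p) * (\<Prod>i\<in>UNIV. A $ i $ p i))"
  proof (rule sum.reindex_bij_witness[of _ ?h' ?h])
    fix p :: "'m \<Rightarrow> 'm" assume p: "p \<in> {p. p permutes UNIV}"
    show "?h' (?h p) = p"
      using p assms inj by (intro map_permutation_compose_inv) auto
    show "?h p \<in> {p. p permutes UNIV}"
      using p assms by (auto intro: map_permutation_permutes)
    show "of_int (sign (?h p)) * (\<Prod>i\<in>UNIV. A $ i $ ?h p i)
        = of_int (sign p) * (\<Prod>i\<in>UNIV. A $ f i $ f (p i))"
      using p term_eq by simp
  next
    fix q :: "'n \<Rightarrow> 'n" assume q: "q \<in> {p. p permutes UNIV}"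
    have bij: "bij (inv_into UNIV f)"
      using assms by (rule bij_betw_inv_into)
    show "?h (?h' q) = q"
      using q bij assms by (intro map_permutation_compose_inv) (auto simp: bij_is_surj surj_f_inv_f)
    show "?h' q \<in> {p. p permutes UNIV}"
      using q bij by (auto intro: map_permutation_permutes)
  qed
  then show ?thesis
    by (simp add: det_def)
qed

definition half_open_cube :: "(real ^ 'n) set"
  where "half_open_cube = {x. \<forall>i. 0 \<le> x $ i \<and> x $ i < 1}"

lemma half_open_cube_lmeasurable: "(half_open_cube :: (real ^ 'n) set) \<in> lmeasurable"
  and measure_half_open_cube: "measure lebesgue (half_open_cube :: (real ^ 'n) set) = 1"
proof -
  let ?Q = "half_open_cube :: (real ^ 'n) set" and ?I = "cbox 0 (\<chi> i. 1) :: (real ^ 'n) set"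
  have "?Q = (\<Inter>i. {x :: real ^ 'n. 0 \<le> x $ i} \<inter> {x. x $ i < 1})"
    by (auto simp: half_open_cube_def)
  also have "\<dots> \<in> sets borel"
    by (intro sets.finite_INT sets.Int borel_closed borel_open closed_Collect_le open_Collect_less
        continuous_intros) auto
  finally have "?Q \<in> sets lebesgue"
    by (metis sets_completionI_sets sets_lborel)
  moreover have sub: "?Q \<subseteq> ?I" "box 0 (\<chi> i. 1) \<subseteq> ?Q"
    by (auto simp: half_open_cube_def mem_box_cart less_imp_le)
  ultimately show Q: "?Q \<in> lmeasurable"
    using bounded_set_imp_lmeasurable bounded_subset bounded_cbox by metis
  have "measure lebesgue ?I = 1"
    using content_cbox_cart[of "0 :: real ^ 'n" "\<chi> i. 1"]
    by (simp add: measure_completion interval_ne_empty_cart)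
  moreover have "measure lebesgue (box 0 (\<chi> i. 1) :: (real ^ 'n) set) = measure lebesgue ?I"
    by (auto simp: measure_lborel_box_eq measure_lborel_cbox_eq)
  moreover have "measure lebesgue (box 0 (\<chi> i. 1) :: (real ^ 'n) set) \<le> measure lebesgue ?Q"
    by (rule measure_mono_fmeasurable[OF sub(2) _ Q]) simp
  moreover have "measure lebesgue ?Q \<le> measure lebesgue ?I"
    by (rule measure_mono_fmeasurable[OF sub(1)]) (use Q in auto)
  ultimately show "measure lebesgue ?Q = 1"
    by linarith
qed

lemma ex_real_vec_half_open_cube: "\<exists>z. x - real_vec z \<in> half_open_cube"
  by (rule exI[of _ "\<chi> i. \<lfloor>x $ i\<rfloor>"]) (auto simp: half_open_cube_def, linarith)

lemma half_open_cube_real_vec_eq: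
  assumes "x - real_vec z \<in> half_open_cube" "x - real_vec w \<in> half_open_cube"
  shows "z = w"
proof -
  have "z $ i = \<lfloor>x $ i\<rfloor>" if "x - real_vec z \<in> half_open_cube" for i and z :: "int ^ 'a"
    using that by (auto simp: half_open_cube_def algebra_simps intro!: floor_unique[symmetric])
  with assms show ?thesis
    by (simp add: vec_eq_iff)
qed

lemma emeasure_lebesgue_translation:
  fixes S :: "'a::euclidean_space set"
  shows "emeasure lebesgue ((+) a ` S) = emeasure lebesgue S"
  using emeasure_lebesgue_affine[of 1 a S] by (simp add: add.commute image_def)

text \<open>
  Let \<open>D r\<close> be the set of points that \<open>A\<close> maps into the integer translate by \<open>r\<close> of the half-open unit
  cube \<open>Q\<close>; its volume is \<open>1 / \<bar>det A\<bar>\<close>. Cut \<open>D r\<close> along the integer translates of \<open>Q\<close> and move all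
  pieces back into \<open>Q\<close>. The union \<open>T r\<close> of the moved pieces consists of the \<open>x\<close> in \<open>Q\<close> such that the
  integer part of \<open>A x\<close> is congruent to \<open>r\<close> modulo the lattice \<open>A \<int>\<^sup>n\<close>. No overlap arises: a point of
  two moved pieces of \<open>D r\<close> would belong to two integer translations with the same image under the
  injective \<open>A\<close>, and \<open>T r\<close> and \<open>T s\<close> are disjoint for incongruent \<open>r\<close> and \<open>s\<close>. So \<open>card R\<close> disjoint sets of volume
  \<open>1 / \<bar>det A\<bar>\<close> fit into \<open>Q\<close>, which has volume 1.
\<close>

lemma card_incongruent_le_det_well_ordered:
  fixes A :: "int ^ 'n::{finite, wellorder} ^ 'n::_" and R :: "(int ^ 'n::_) set"
  assumes inv: "invertible (real_mat A)" and fin: "finite R"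
    and incong: "\<And>r s u. r \<in> R \<Longrightarrow> s \<in> R \<Longrightarrow> r - s = A *v u \<Longrightarrow> r = s"
  shows "int (card R) \<le> \<bar>det A\<bar>"
proof -
  let ?M = "real_mat A" and ?Q = "half_open_cube :: (real ^ 'n::_) set"
  note inv_simps = matrix_inv_mult_vector[OF inv]
  define D where "D r = {x. ?M *v x - real_vec r \<in> ?Q}" for r
  define E where "E r z = ?Q \<inter> (+) (- real_vec z) ` D r" for r z
  define T where "T r = (\<Union>z. E r z)" for r
  have E_iff: "x \<in> E r z \<longleftrightarrow> x \<in> ?Q \<and> x + real_vec z \<in> D r" for x r z
    unfolding E_def by (auto simp: image_iff algebra_simps intro!: bexI[of _ "x + real_vec z"])
  have image_D: "(*v) ?M ` D r = (+) (real_vec r) ` ?Q" for r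
  proof (intro Set.set_eqI iffI)
    fix y assume "y \<in> (+) (real_vec r) ` ?Q"
    then have "matrix_inv ?M *v y \<in> D r"
      by (auto simp: D_def inv_simps)
    then show "y \<in> (*v) ?M ` D r"
      by (metis inv_simps(1) imageI)
  qed (auto simp: D_def image_iff intro!: bexI[of _ "_ - real_vec r"])
  have "D r = (*v) (matrix_inv ?M) ` (*v) ?M ` D r" for r
    by (simp add: image_image inv_simps)
  then have D_meas: "D r \<in> lmeasurable" for r
    using measurable_linear_image[OF matrix_vector_mul_linear
        measurable_translation[OF half_open_cube_lmeasurable]]
    by (metis image_D)
  have measure_D: "\<bar>det ?M\<bar> * measure lebesgue (D r) = 1" for r
    using measure_linear_image[OF matrix_vector_mul_linear[of ?M] D_meas, of r]
    by (simp add: image_D measure_translation measure_half_open_cube)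
  have E_sets: "E r z \<in> sets lebesgue" for r z
    unfolding E_def
    by (intro sets.Int fmeasurableD half_open_cube_lmeasurable measurable_translation D_meas)
  have T_sets: "T r \<in> sets lebesgue" for r
    unfolding T_def by (rule sets.countable_UN'') (auto simp: E_sets)
  \<comment> \<open>The integer part of \<open>A x\<close> is congruent to \<open>r\<close>.\<close>
  have T_step: "\<exists>u. ?M *v x - real_vec (r - A *v u) \<in> ?Q" if "x \<in> T r" for x r
  proof -
    from that obtain z where "?M *v (x + real_vec z) - real_vec r \<in> ?Q"
      by (auto simp: T_def E_iff D_def)
    then show ?thesis
      by (intro exI[of _ z])
        (simp add: real_vec_diff matrix_vector_right_distrib real_mat_mult_real_vec algebra_simps)
  qed
  have emeasure_T: "emeasure lebesgue (T r) = emeasure lebesgue (D r)" for r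
  proof -
    have "disjoint_family (E r)"
    proof (unfold disjoint_family_on_def, intro ballI impI equals0I)
      fix z w x assume "z \<noteq> w" and x: "x \<in> E r z \<inter> E r w"
      have "?M *v x - real_vec (r - A *v z) \<in> ?Q" "?M *v x - real_vec (r - A *v w) \<in> ?Q"
        using x
        by (auto simp: E_iff D_def real_vec_diff matrix_vector_right_distrib
            real_mat_mult_real_vec algebra_simps)
      then have "r - A *v z = r - A *v w"
        by (rule half_open_cube_real_vec_eq)
      then have "?M *v real_vec z = ?M *v real_vec w"
        by (simp add: real_mat_mult_real_vec)
      then have "real_vec z = real_vec w"
        by (metis inv_simps(2))
      with \<open>z \<noteq> w\<close> show False
        by (simp add: real_vec_inject)
    qed
    then have "emeasure lebesgue (T r) = (\<integral>\<^sup>+z. emeasure lebesgue (E r z) \<partial>count_space UNIV)"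
      unfolding T_def by (intro emeasure_UN_countable E_sets) auto
    also have "\<dots> = (\<integral>\<^sup>+z. emeasure lebesgue ((+) (real_vec z) ` E r z) \<partial>count_space UNIV)"
      by (simp add: emeasure_lebesgue_translation)
    also have "\<dots> = emeasure lebesgue (\<Union>z. (+) (real_vec z) ` E r z)"
    proof (rule emeasure_UN_countable[symmetric])
      show "disjoint_family (\<lambda>z. (+) (real_vec z) ` E r z)"
        unfolding disjoint_family_on_def
        by (auto simp: E_iff dest: half_open_cube_real_vec_eq)
           (metis E_iff add_diff_cancel_left' half_open_cube_real_vec_eq)
    qed (auto intro: lebesgue_sets_translation E_sets)
    also have "(\<Union>z. (+) (real_vec z) ` E r z) = D r"
    proof (intro Set.set_eqI iffI)
      fix x assume x: "x \<in> D r"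
      obtain z where "x - real_vec z \<in> ?Q"
        using ex_real_vec_half_open_cube by blast
      with x have "x - real_vec z \<in> E r z"
        by (simp add: E_iff)
      then show "x \<in> (\<Union>z. (+) (real_vec z) ` E r z)"
        by (force simp: image_iff)
    qed (auto simp: E_iff add.commute)
    finally show ?thesis .
  qed
  have "disjoint_family_on T R"
  proof (unfold disjoint_family_on_def, intro ballI impI equals0I)
    fix r s x assume rs: "r \<in> R" "s \<in> R" "r \<noteq> s" and "x \<in> T r \<inter> T s"
    then obtain u w where "?M *v x - real_vec (r - A *v u) \<in> ?Q" "?M *v x - real_vec (s - A *v w) \<in> ?Q"
      using T_step by blast
    then have "r - A *v u = s - A *v w"
      by (rule half_open_cube_real_vec_eq)
    then have "r - s = A *v (u - w)"
      by (simp add: matrix_vector_mult_diff_distrib algebra_simps)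
    with rs incong show False
      by blast
  qed
  then have "(\<Sum>r\<in>R. emeasure lebesgue (T r)) = emeasure lebesgue (\<Union>r\<in>R. T r)"
    by (intro sum_emeasure fin) (auto simp: T_sets)
  also have "\<dots> \<le> emeasure lebesgue ?Q"
    by (intro emeasure_mono fmeasurableD half_open_cube_lmeasurable) (auto simp: T_def E_def)
  also have "\<dots> = ennreal 1"
    using half_open_cube_lmeasurable
    by (subst emeasure_eq_measure2) (auto simp: measure_half_open_cube)
  also have "(\<Sum>r\<in>R. emeasure lebesgue (T r)) = (\<Sum>r\<in>R. ennreal (measure lebesgue (D r)))"
    by (simp add: emeasure_T emeasure_eq_measure2 D_meas)
  also have "\<dots> = ennreal (\<Sum>r\<in>R. measure lebesgue (D r))"
    by (simp add: sum_ennreal)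
  finally have le1: "(\<Sum>r\<in>R. measure lebesgue (D r)) \<le> 1"
    by (simp add: ennreal_le_iff)
  have "real (card R) = (\<Sum>r\<in>R. \<bar>det ?M\<bar> * measure lebesgue (D r))"
    by (simp add: measure_D)
  also have "\<dots> = \<bar>det ?M\<bar> * (\<Sum>r\<in>R. measure lebesgue (D r))"
    by (simp add: sum_distrib_left)
  also have "\<dots> \<le> \<bar>det ?M\<bar> * 1"
    using le1 by (intro mult_left_mono) auto
  finally have "real (card R) \<le> of_int \<bar>det A\<bar>"
    by (simp add: det_real_mat)
  then show ?thesis
    by linarith
qed

text \<open>
  Renaming the indices changes neither the determinant nor congruence modulo the lattice, so the
  index type need not be ordered.
\<close>

lemma card_incongruent_le_det:
  fixes A :: "int ^ 'n ^ 'n" and R :: "(int ^ 'n) set"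
  assumes inv: "invertible (real_mat A)" and fin: "finite R"
    and incong: "\<And>r s u. r \<in> R \<Longrightarrow> s \<in> R \<Longrightarrow> r - s = A *v u \<Longrightarrow> r = s"
  shows "int (card R) \<le> \<bar>det A\<bar>"
proof -
  let ?f = "Rep_well_ordered :: 'n well_ordered \<Rightarrow> 'n"
  define B where "B = (\<chi> i j. A $ ?f i $ ?f j)"
  define h where "h x = (\<chi> i. x $ ?f i)" for x :: "int ^ 'n"
  have det_B: "det B = det A"
    unfolding B_def by (rule det_reindex[OF bij_Rep_well_ordered])
  have inj: "inj h"
    by (auto simp: inj_def h_def vec_eq_iff) (metis Abs_well_ordered_inverse UNIV_I)
  have "invertible (real_mat B)"
    using inv by (simp add: invertible_det_nz det_real_mat det_B)
  moreover have "r = s" if rs: "r \<in> h ` R" "s \<in> h ` R" "r - s = B *v u" for r s u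
  proof -
    obtain x y where xy: "x \<in> R" "y \<in> R" "r = h x" "s = h y"
      using rs by auto
    define w where "w = (\<chi> j. u $ Abs_well_ordered j)"
    have "u = h w"
      by (simp add: h_def w_def Rep_well_ordered_inverse)
    have "B *v h w = h (A *v w)"
      using sum.reindex_bij_betw[OF bij_Rep_well_ordered, of "\<lambda>j. A $ ?f i $ j * w $ j" for i]
      unfolding B_def h_def by (simp add: vec_eq_iff matrix_vector_mult_def)
    then have "h (x - y) = h (A *v w)"
      using rs(3) xy \<open>u = h w\<close> by (simp add: h_def vec_eq_iff)
    then have "x - y = A *v w"
      using inj by (simp add: inj_eq)
    with incong xy show ?thesis
      by blast
  qed
  ultimately have "int (card (h ` R)) \<le> \<bar>det B\<bar>"
    using fin by (intro card_incongruent_le_det_well_ordered) auto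
  then show ?thesis
    using inj by (simp add: card_image inj_on_subset det_B)
qed

section \<open>The quotient of a lattice by the integer lattice\<close>

text \<open>
  The coset of \<open>A\<inverse> z\<close> modulo the integer lattice. Indexing the elements of the quotient by integer
  vectors identifies it with the quotient of \<open>\<int>\<^sup>n\<close> by \<open>A \<int>\<^sup>n\<close>, in which everything below is computed.
\<close>

definition lattice_coset :: "int ^ 'n ^ 'n \<Rightarrow> int ^ 'n \<Rightarrow> (real ^ 'n) set"
  where "lattice_coset A z = {real_vec h + matrix_inv (real_mat A) *v real_vec z | h. True}"

definition lattice_quotient :: "int ^ 'n ^ 'n \<Rightarrow> (real ^ 'n) set monoid"
  where "lattice_quotient A =
    additive_group (dual_lattice ((*v) (transpose (real_mat A)) ` int_lattice)) Mod int_lattice"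

context
  fixes A :: "int ^ 'n ^ 'n"
  assumes inv: "invertible (real_mat A)"
begin

lemma carrier_lattice_quotient: "carrier (lattice_quotient A) = range (lattice_coset A)"
  unfolding lattice_quotient_def dual_lattice_eq_inv_image[OF inv] carrier_FactGroup
  by (simp add: additive_group_def r_coset_def int_lattice_def lattice_coset_def image_image)
    (auto simp: image_def)

lemma one_lattice_quotient: "\<one>\<^bsub>lattice_quotient A\<^esub> = lattice_coset A 0"
  by (auto simp: lattice_quotient_def lattice_coset_def int_lattice_def real_vec_0)

lemma mult_lattice_quotient:
  "lattice_coset A z \<otimes>\<^bsub>lattice_quotient A\<^esub> lattice_coset A w = lattice_coset A (z + w)"
proof -
  let ?M = "matrix_inv (real_mat A)"
  have "lattice_coset A z \<otimes>\<^bsub>lattice_quotient A\<^esub> lattice_coset A w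
      = {x + y | x y. x \<in> lattice_coset A z \<and> y \<in> lattice_coset A w}"
    by (auto simp: lattice_quotient_def set_mult_def additive_group_def)
  also have "\<dots> = lattice_coset A (z + w)"
  proof (intro Set.set_eqI iffI)
    fix x assume "x \<in> {x + y | x y. x \<in> lattice_coset A z \<and> y \<in> lattice_coset A w}"
    then obtain h k where "x = (real_vec h + ?M *v real_vec z) + (real_vec k + ?M *v real_vec w)"
      by (auto simp: lattice_coset_def)
    then have "x = real_vec (h + k) + ?M *v real_vec (z + w)"
      by (simp add: real_vec_add matrix_vector_right_distrib)
    then show "x \<in> lattice_coset A (z + w)"
      by (auto simp: lattice_coset_def)
  next
    fix x assume "x \<in> lattice_coset A (z + w)"
    then obtain h where "x = real_vec h + ?M *v real_vec (z + w)"
      by (auto simp: lattice_coset_def)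
    then have "x = (real_vec h + ?M *v real_vec z) + (real_vec 0 + ?M *v real_vec w)"
      by (simp add: real_vec_add real_vec_0 matrix_vector_right_distrib)
    then show "x \<in> {x + y | x y. x \<in> lattice_coset A z \<and> y \<in> lattice_coset A w}"
      unfolding lattice_coset_def by blast
  qed
  finally show ?thesis .
qed

lemma group_lattice_quotient: "group (lattice_quotient A)"
proof (rule groupI)
  fix x assume "x \<in> carrier (lattice_quotient A)"
  then obtain z where "x = lattice_coset A z"
    by (auto simp: carrier_lattice_quotient)
  then have "lattice_coset A (- z) \<otimes>\<^bsub>lattice_quotient A\<^esub> x = \<one>\<^bsub>lattice_quotient A\<^esub>"
    by (simp only: mult_lattice_quotient one_lattice_quotient) simp
  then show "\<exists>y\<in>carrier (lattice_quotient A). y \<otimes>\<^bsub>lattice_quotient A\<^esub> x = \<one>\<^bsub>lattice_quotient A\<^esub>"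
    unfolding carrier_lattice_quotient by blast
qed (auto simp only: carrier_lattice_quotient one_lattice_quotient mult_lattice_quotient add.assoc
    add_0_left)

lemma lattice_coset_eq_iff: "lattice_coset A z = lattice_coset A w \<longleftrightarrow> (\<exists>u. z - w = A *v u)"
proof
  let ?M = "matrix_inv (real_mat A)"
  assume "lattice_coset A z = lattice_coset A w"
  moreover have "real_vec 0 + ?M *v real_vec z \<in> lattice_coset A z"
    unfolding lattice_coset_def by blast
  ultimately obtain h where "?M *v real_vec z = real_vec h + ?M *v real_vec w"
    by (auto simp: lattice_coset_def real_vec_0)
  then have "real_vec z = real_mat A *v (real_vec h + ?M *v real_vec w)"
    by (metis matrix_inv_mult_vector(1)[OF inv])
  also have "\<dots> = real_vec (A *v h + w)"
    by (simp add: matrix_vector_right_distrib matrix_inv_mult_vector[OF inv] real_vec_add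
        real_mat_mult_real_vec)
  finally show "\<exists>u. z - w = A *v u"
    by (intro exI[of _ h]) (simp add: real_vec_inject)
next
  let ?M = "matrix_inv (real_mat A)"
  assume "\<exists>u. z - w = A *v u"
  then obtain u where "z = A *v u + w"
    by (metis diff_add_cancel)
  then have z: "?M *v real_vec z = real_vec u + ?M *v real_vec w"
    by (simp add: real_vec_add real_mat_mult_real_vec[symmetric] matrix_vector_right_distrib
        matrix_inv_mult_vector[OF inv])
  show "lattice_coset A z = lattice_coset A w"
  proof (intro Set.set_eqI iffI)
    fix x assume "x \<in> lattice_coset A z"
    then obtain h where "x = real_vec (h + u) + ?M *v real_vec w"
      by (auto simp: lattice_coset_def z real_vec_add add.assoc)
    then show "x \<in> lattice_coset A w"
      unfolding lattice_coset_def by blast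
  next
    fix x assume "x \<in> lattice_coset A w"
    then obtain h where "x = real_vec (h - u) + ?M *v real_vec z"
      by (auto simp: lattice_coset_def z real_vec_diff)
    then show "x \<in> lattice_coset A z"
      unfolding lattice_coset_def by blast
  qed
qed

lemma order_lattice_quotient:
  "finite (carrier (lattice_quotient A))" "int (order (lattice_quotient A)) \<le> \<bar>det A\<bar>"
proof -
  have "card C \<le> nat \<bar>det A\<bar>" if C: "C \<subseteq> carrier (lattice_quotient A)" "finite C" for C
  proof -
    obtain R where R: "finite R" "C = lattice_coset A ` R" "inj_on (lattice_coset A) R"
      using C unfolding carrier_lattice_quotient by (metis finite_imageD subset_image_inj)
    have "int (card R) \<le> \<bar>det A\<bar>"
    proof (rule card_incongruent_le_det[OF inv R(1)])
      fix r s u assume "r \<in> R" "s \<in> R" "r - s = A *v u"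
      then show "r = s"
        using R(3) lattice_coset_eq_iff by (metis inj_on_def)
    qed
    then show ?thesis
      using R by (simp add: card_image)
  qed
  then have "finite (carrier (lattice_quotient A)) \<and> card (carrier (lattice_quotient A)) \<le> nat \<bar>det A\<bar>"
    by (rule finite_if_finite_subsets_card_bdd)
  then show "finite (carrier (lattice_quotient A))" "int (order (lattice_quotient A)) \<le> \<bar>det A\<bar>"
    by (auto simp: order_def)
qed

lemma generate_unit_cosets:
  "generate (lattice_quotient A) (range (\<lambda>i. lattice_coset A (axis i 1))) = carrier (lattice_quotient A)"
proof -
  interpret group "lattice_quotient A"
    by (rule group_lattice_quotient)
  let ?H = "range (\<lambda>i. lattice_coset A (axis i 1))"
  let ?S = "{z. lattice_coset A z \<in> generate (lattice_quotient A) ?H}"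
  have H: "?H \<subseteq> carrier (lattice_quotient A)"
    by (auto simp: carrier_lattice_quotient)
  have zero: "0 \<in> ?S"
    using generate.one[of "lattice_quotient A" ?H] unfolding one_lattice_quotient by simp
  have add: "z + w \<in> ?S" if "z \<in> ?S" "w \<in> ?S" for z w
    using generate.eng[of _ "lattice_quotient A" ?H] that mult_lattice_quotient by (metis mem_Collect_eq)
  have neg_axis: "- axis i 1 \<in> ?S" for i
  proof -
    have "inv\<^bsub>lattice_quotient A\<^esub> lattice_coset A (axis i 1) = lattice_coset A (- axis i 1)"
      by (rule inv_equality)
        (auto simp only: mult_lattice_quotient one_lattice_quotient carrier_lattice_quotient
          left_minus)
    then show ?thesis
      using generate.inv[of "lattice_coset A (axis i 1)" ?H "lattice_quotient A"] by auto
  qed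
  have axis: "axis i k \<in> ?S" for i k
  proof (induction k rule: int_induct[where k = 0])
    case base
    then show ?case
      using zero by (simp add: axis_def zero_vec_def)
  next
    case (step1 k)
    have "axis i (k + 1) = axis i k + axis i 1"
      by (simp add: vec_eq_iff axis_def)
    moreover have "axis i 1 \<in> ?S"
      by (auto intro: generate.incl)
    ultimately show ?case
      using add[OF step1.IH] by simp
  next
    case (step2 k)
    have "axis i (k - 1) = axis i k + - axis i 1"
      by (simp add: vec_eq_iff axis_def)
    then show ?case
      using add[OF step2.IH neg_axis] by simp
  qed
  have sum_axis: "(\<Sum>i\<in>I. axis i (z $ i)) \<in> ?S" if "finite I" for I and z :: "int ^ 'n"
    using that
  proof (induction I)
    case empty
    then show ?case
      using zero by simp
  next
    case (insert i I)
    then show ?case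
      using add[OF axis] by simp
  qed
  have "z \<in> ?S" for z
  proof -
    have "z = (\<Sum>i\<in>UNIV. axis i (z $ i))"
      by (simp add: vec_eq_iff axis_def)
    then show ?thesis
      using sum_axis[of UNIV z] by simp
  qed
  then have "carrier (lattice_quotient A) \<subseteq> generate (lattice_quotient A) ?H"
    by (auto simp: carrier_lattice_quotient)
  with generate_incl[OF H] show ?thesis
    by blast
qed

text \<open>
  The cosets of the unit vectors generate the quotient. Writing the class of \<open>z\<close> as a sum of at
  most as many of them as the diameter allows replaces \<open>z\<close>, modulo the lattice \<open>A \<int>\<^sup>n\<close>, by a nonnegative vector whose entries
  count how often each generator occurs; their sum is the number of summands.
\<close>

lemma nonneg_representative:
  fixes z :: "int ^ 'n"
  obtains y u where "\<And>i. 0 \<le> y $ i" "(\<Sum>i\<in>UNIV. y $ i) \<le> int (group_diam (lattice_quotient A))"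
    "z = y + A *v u"
proof -
  interpret group "lattice_quotient A"
    by (rule group_lattice_quotient)
  let ?H = "range (\<lambda>i. lattice_coset A (axis i 1))"
  \<comment> \<open>A word of unit cosets is the coset of the vector that counts its letters.\<close>
  have words: "\<exists>y. (\<forall>i. 0 \<le> y $ i) \<and> (\<Sum>i\<in>UNIV. y $ i) = int (length hs)
      \<and> foldr (\<lambda>x y. x \<otimes>\<^bsub>lattice_quotient A\<^esub> y) hs \<one>\<^bsub>lattice_quotient A\<^esub> = lattice_coset A y"
    if "set hs \<subseteq> ?H" for hs
    using that
  proof (induction hs)
    case Nil
    then show ?case
      by (intro exI[of _ 0]) (simp only: one_lattice_quotient foldr.simps id_apply, simp)
  next
    case (Cons h hs)
    then obtain y where y: "\<forall>i. 0 \<le> y $ i" "(\<Sum>i\<in>UNIV. y $ i) = int (length hs)"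
      "foldr (\<lambda>x y. x \<otimes>\<^bsub>lattice_quotient A\<^esub> y) hs \<one>\<^bsub>lattice_quotient A\<^esub> = lattice_coset A y"
      by auto
    obtain j where j: "h = lattice_coset A (axis j 1)"
      using Cons.prems by auto
    have "(\<Sum>i\<in>UNIV. (axis j 1 + y) $ i) = int (length (h # hs))"
      using y(2) by (simp add: sum.distrib axis_def)
    moreover have "\<forall>i. 0 \<le> (axis j 1 + y) $ i"
      using y(1) by (simp add: axis_def)
    moreover have "foldr (\<lambda>x y. x \<otimes>\<^bsub>lattice_quotient A\<^esub> y) (h # hs) \<one>\<^bsub>lattice_quotient A\<^esub>
        = lattice_coset A (axis j 1 + y)"
      using y(3) j mult_lattice_quotient by simp
    ultimately show ?case
      by blast
  qed
  have H: "?H \<subseteq> carrier (lattice_quotient A)"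
    by (auto simp: carrier_lattice_quotient)
  have "lattice_coset A z \<in> word_products (lattice_quotient A) ?H (diam_wrt (lattice_quotient A) ?H)"
    using carrier_subset_word_products_diam[OF order_lattice_quotient(1) H generate_unit_cosets]
    by (auto simp: carrier_lattice_quotient)
  then obtain hs where hs: "set hs \<subseteq> ?H" "length hs \<le> diam_wrt (lattice_quotient A) ?H"
    "lattice_coset A z = foldr (\<lambda>x y. x \<otimes>\<^bsub>lattice_quotient A\<^esub> y) hs \<one>\<^bsub>lattice_quotient A\<^esub>"
    unfolding word_products_def by blast
  obtain y where y: "\<forall>i. 0 \<le> y $ i" "(\<Sum>i\<in>UNIV. y $ i) = int (length hs)"
    "lattice_coset A z = lattice_coset A y"
    using words[OF hs(1)] hs(3) by auto
  then obtain u where "z - y = A *v u"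
    using lattice_coset_eq_iff by blast
  then have "z = y + A *v u"
    by (simp add: algebra_simps)
  moreover have "(\<Sum>i\<in>UNIV. y $ i) \<le> int (group_diam (lattice_quotient A))"
    using y(2) hs(2) diam_wrt_le_group_diam[OF order_lattice_quotient(1) H generate_unit_cosets]
    by simp
  ultimately show thesis
    using that y(1) by blast
qed

end

section \<open>The facet width of a lattice-free simplex\<close>

lemma row_inner:
  fixes M :: "real ^ 'n ^ 'm"
  shows "row i M \<bullet> x = (M *v x) $ i"
  by (simp add: row_def inner_vec_def matrix_vector_mult_def)

text \<open>
  The dual cone of \<open>cone_of A\<close> is spanned by the linearly independent rows of \<open>A\<close>, so an interior point
  is a combination of them with positive coefficients. To see that the coefficient of the row \<open>i\<close> is
  positive, move the point a little in the direction opposite to this row and pair the result with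
  the column \<open>i\<close> of the inverse matrix, which lies in the cone and is orthogonal to all other rows.
\<close>

lemma interior_dual_cone_coefficients:
  fixes A :: "int ^ 'n ^ 'n" and c :: "real ^ 'n"
  assumes inv: "invertible (real_mat A)"
    and int: "- c \<in> interior (dual_cone_of (cone_of A))"
  obtains \<mu> :: "real ^ 'n" where "\<And>i. 0 < \<mu> $ i" "\<And>x. c \<bullet> x = - (\<mu> \<bullet> (real_mat A *v x))"
proof -
  let ?M = "real_mat A"
  define \<mu> where "\<mu> = - (c v* matrix_inv ?M)"
  have c: "c \<bullet> x = - (\<mu> \<bullet> (?M *v x))" for x
    by (simp add: \<mu>_def dot_lmul_matrix matrix_inv_mult_vector[OF inv])
  obtain e where e: "0 < e" "ball (- c) e \<subseteq> dual_cone_of (cone_of A)"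
    using int by (auto simp: mem_interior)
  have "0 < \<mu> $ i" for i
  proof -
    \<comment> \<open>The factor 2 and the summand 1 make the step shorter than \<open>e\<close> without division by zero.\<close>
    define t where "t = e / (2 * (1 + norm (row i ?M)))"
    have pos: "0 < 1 + norm (row i ?M)"
      by (smt (verit) norm_ge_zero)
    then have t: "0 < t"
      using e(1) by (simp add: t_def)
    have "norm (row i ?M) < 2 * (1 + norm (row i ?M))"
      by (smt (verit) norm_ge_zero)
    then have "t * norm (row i ?M) < t * (2 * (1 + norm (row i ?M)))"
      using t by (rule mult_strict_left_mono)
    also have "\<dots> = e"
      using pos by (simp add: t_def)
    finally have "- c - t *\<^sub>R row i ?M \<in> dual_cone_of (cone_of A)"
      using t e(2) by (auto simp: dist_norm)
    moreover define y where "y = matrix_inv ?M *v axis i 1"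
    have My: "?M *v y = axis i 1"
      by (simp add: y_def matrix_inv_mult_vector[OF inv])
    then have "y \<in> cone_of A"
      by (simp add: cone_of_def less_eq_vec_def axis_def)
    ultimately have "0 \<le> y \<bullet> (- c - t *\<^sub>R row i ?M)"
      by (auto simp: dual_cone_of_def)
    moreover have "y \<bullet> c = - \<mu> $ i"
      using c[of y] My by (simp add: inner_commute inner_axis)
    moreover have "y \<bullet> row i ?M = (?M *v y) $ i"
      by (simp add: row_inner inner_commute[of y])
    ultimately have "t \<le> \<mu> $ i"
      by (simp add: My inner_diff_right)
    with t show ?thesis
      by linarith
  qed
  with c that show thesis
    by blast
qed

text \<open>
  In the slack coordinates \<open>y = b - A x\<close>, the simplex is given by \<open>y \<ge> 0\<close> and \<open>\<mu> \<bullet> y \<le> \<beta>\<close>, where \<open>\<beta>\<close> is the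
  numerator on the right-hand side. So \<open>y $ i\<close> stays between 0 and \<open>\<beta> / \<mu> $ i\<close> on it, and the width along
  the row \<open>i\<close> of \<open>A\<close> is the width along the coordinate \<open>y $ i\<close>.
\<close>

lemma facet_width_simplex_le:
  fixes A :: "int ^ 'n ^ 'n" and v \<mu> :: "real ^ 'n"
  assumes v: "real_mat A *v v = real_vec b" and apex: "real_vec a \<bullet> v < of_int b\<^sub>a"
    and pos: "\<And>i. 0 < \<mu> $ i"
    and a: "\<And>x. real_vec a \<bullet> x = - (\<mu> \<bullet> (real_mat A *v x))"
  shows "facet_width (facet_normals A a) (simplex_of A a b b\<^sub>a)
    \<le> (of_int b\<^sub>a - real_vec a \<bullet> v) / \<mu> $ i"
proof -
  let ?M = "real_mat A" and ?P = "simplex_of A a b b\<^sub>a" and ?r = "row i (real_mat A)"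
  let ?\<beta> = "of_int b\<^sub>a - real_vec a \<bullet> v"
  have row: "?r \<bullet> x = (?M *v x) $ i" for x
    by (simp add: row_inner)
  have ne: "?P \<noteq> {}"
    using v apex by (auto simp: simplex_of_def intro!: exI[of _ v])
  have upper: "?r \<bullet> x \<le> of_int (b $ i)" if "x \<in> ?P" for x
    using that by (simp add: row simplex_of_def less_eq_vec_def)
  have lower: "of_int (b $ i) - ?\<beta> / \<mu> $ i \<le> ?r \<bullet> x" if x: "x \<in> ?P" for x
  proof -
    let ?y = "real_vec b - ?M *v x"
    have "0 \<le> ?y $ j" for j
      using x by (simp add: simplex_of_def less_eq_vec_def)
    then have "0 \<le> \<mu> $ j * ?y $ j" for j
      using pos[of j] by (intro mult_nonneg_nonneg) auto
    then have "\<mu> $ i * ?y $ i \<le> \<mu> \<bullet> ?y"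
      unfolding inner_vec_def inner_real_def by (intro member_le_sum) auto
    also have "\<mu> \<bullet> ?y = real_vec a \<bullet> x - real_vec a \<bullet> v"
      by (simp add: inner_diff_right a v)
    also have "\<dots> \<le> ?\<beta>"
      using x by (simp add: simplex_of_def)
    finally have "?y $ i \<le> ?\<beta> / \<mu> $ i"
      using pos[of i] by (simp add: pos_le_divide_eq mult.commute)
    then show ?thesis
      by (simp add: row)
  qed
  have "(SUP x\<in>?P. ?r \<bullet> x) \<le> of_int (b $ i)"
    by (rule cSUP_least[OF ne upper])
  moreover have "of_int (b $ i) - ?\<beta> / \<mu> $ i \<le> (INF x\<in>?P. ?r \<bullet> x)"
    by (rule cINF_greatest[OF ne lower])
  ultimately have "width_along ?r ?P \<le> ?\<beta> / \<mu> $ i"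
    by (simp add: width_along_def)
  moreover have "facet_width (facet_normals A a) ?P \<le> width_along ?r ?P"
    unfolding facet_width_def facet_normals_def
    by (intro Min_le) (auto simp: rows_def full_SetCompr_eq)
  ultimately show ?thesis
    by linarith
qed

theorem corollary1p3:
  fixes A :: "int ^ 'n ^ 'n" and a b :: "int ^ 'n" and b\<^sub>a \<delta> :: int
    and v :: "real ^ 'n" and P \<Lambda> :: "(real ^ 'n) set"
  assumes "invertible (real_mat A)"
    and "real_mat A *v v = real_vec b"
    and "- real_vec a \<in> interior (dual_cone_of (cone_of A))"
    and "of_int b\<^sub>a > real_vec a \<bullet> v"
    and "P = simplex_of A a b b\<^sub>a"
    and "lattice_free P"
    and "\<delta> = min_abs_det (append_row A a)"
    and "\<bar>det A\<bar> = \<delta>"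
    and "\<Lambda> = dual_lattice ((*v) (transpose (real_mat A)) ` int_lattice)"
  shows "facet_width (facet_normals A a) P
      < real (group_diam (additive_group \<Lambda> Mod int_lattice))
    \<and> int (group_diam (additive_group \<Lambda> Mod int_lattice)) \<le> \<delta> - 1"
proof -
  note inv = assms(1) and apex = assms(4)
  have quotient: "additive_group \<Lambda> Mod int_lattice = lattice_quotient A"
    by (simp only: assms(9) lattice_quotient_def)
  let ?M = "real_mat A" and ?k = "group_diam (lattice_quotient A)"
  let ?\<beta> = "of_int b\<^sub>a - real_vec a \<bullet> v"
  obtain \<mu> where pos: "\<And>i. 0 < \<mu> $ i" and a: "\<And>x. real_vec a \<bullet> x = - (\<mu> \<bullet> (?M *v x))"
    using interior_dual_cone_coefficients[OF inv assms(3)] by blast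
  obtain y u where y: "\<And>i. 0 \<le> y $ i" "(\<Sum>i\<in>UNIV. y $ i) \<le> int ?k" and b: "b = y + A *v u"
    using nonneg_representative[OF inv] by blast
  have Mu: "?M *v real_vec u = real_vec b - real_vec y"
    by (simp add: b real_mat_mult_real_vec real_vec_add)
  \<comment> \<open>The integer point \<open>u\<close> has the slack vector \<open>y\<close>, so only the last inequality can fail for it.\<close>
  have "real_vec u \<notin> P"
    using assms(6) by (auto simp: lattice_free_def int_lattice_def)
  moreover have "?M *v real_vec u \<le> real_vec b"
    using y(1) by (simp add: Mu less_eq_vec_def)
  ultimately have "of_int b\<^sub>a < real_vec a \<bullet> real_vec u"
    by (auto simp: assms(5) simplex_of_def)
  also have "real_vec a \<bullet> real_vec u = real_vec a \<bullet> v + \<mu> \<bullet> real_vec y"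
    by (simp add: a Mu assms(2) inner_diff_right)
  finally have \<beta>: "?\<beta> < \<mu> \<bullet> real_vec y"
    by simp
  \<comment> \<open>The largest coefficient belongs to the smallest width among the rows of \<open>A\<close>.\<close>
  have "Max (range (\<lambda>j. \<mu> $ j)) \<in> range (\<lambda>j. \<mu> $ j)"
    by (rule Max_in) auto
  then obtain i where "Max (range (\<lambda>j. \<mu> $ j)) = \<mu> $ i"
    by blast
  then have i: "\<mu> $ j \<le> \<mu> $ i" for j
    by (metis Max_ge finite finite_imageI rangeI)
  have "\<mu> \<bullet> real_vec y \<le> (\<Sum>j\<in>UNIV. \<mu> $ i * of_int (y $ j))"
    unfolding inner_vec_def inner_real_def
    using i y(1) by (intro sum_mono) (simp add: mult_right_mono)
  also have "\<dots> = \<mu> $ i * of_int (\<Sum>j\<in>UNIV. y $ j)"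
    by (simp add: sum_distrib_left)
  also have "\<dots> \<le> \<mu> $ i * real ?k"
    using y(2) pos[of i] by (intro mult_left_mono) linarith+
  finally have "?\<beta> / \<mu> $ i < real ?k"
    using \<beta> pos[of i] by (simp add: pos_divide_less_eq mult.commute)
  with facet_width_simplex_le[OF assms(2) apex pos a, of i]
  have "facet_width (facet_normals A a) P < real ?k"
    by (simp add: assms(5))
  moreover
  have "int ?k \<le> \<delta> - 1"
  proof -
    interpret group "lattice_quotient A"
      by (rule group_lattice_quotient[OF inv])
    note order = order_lattice_quotient[OF inv]
    have "0 < order (lattice_quotient A)"
      using order(1) order_gt_0_iff_finite by blast
    then show ?thesis
      using group_diam_le[OF order(1)] order(2) assms(8) by linarith
  qed
  ultimately show ?thesis
    by (simp add: quotient)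
qed

end
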